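(* Let $\varphi_1\colon 2^{S_1}\to \mathbb{R}$ be a submodular function over a finite ground set $S_1$, and let $\varphi_2\colon 2^{S_2} \to \mathbb{R}_+$ denote the rank function of the uniform matroid $U_{2,3}$ (so $|S_2|=3$ and $\varphi_2(Y)=\min\{|Y|,2\}$). (a) If $\varphi_1$ and $\varphi_2$ have a submodular tensor product, then $\varphi_1$ satisfies Ingleton's inequality \[ \varphi_1(A\cup B)+\varphi_1(A\cup C)+\varphi_1(A\cup D)+\varphi_1(B\cup C)+\varphi_1(B\cup D)\ \ge\ \varphi_1(A)+\varphi_1(B)+\varphi_1(A\cup B\cup C)+\varphi_1(A\cup B\cup D)+\varphi_1(C\cup D) \] for all pairwise disjoint sets $A,B,C,D\subseteq S_1$. (b) If $\varphi_1$ and $\varphi_2$ have a tensor product which is a polymatroid function, then $\varphi_1$ satisfies the same Ingleton inequality for all sets $A,B,C,D\subseteq S_1$.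
   Context: A function $\varphi\colon 2^{S_1\times S_2}\to\mathbb{R}$ is a tensor product of $\varphi_1$ and $\varphi_2$ if $\varphi(X_1\times X_2)=\varphi_1(X_1)\cdot\varphi_2(X_2)$ for every $X_1\subseteq S_1$, $X_2\subseteq S_2$. A set function is submodular if $\varphi(X)+\varphi(Y)\ge\varphi(X\cap Y)+\varphi(X\cup Y)$ for all $X,Y$. A polymatroid function is a nonnegative, increasing, submodular set function with value $0$ on the empty set. *)

theory Defs
  imports Complex_Main
begin

text \<open>
  A set function \<open>2\<^sup>S \<rightarrow> \<real>\<close> is a function of type \<open>'a set \<Rightarrow> real\<close>; every notion below carries
  its ground set \<open>S\<close> and looks only at the values on subsets of \<open>S\<close>.
\<close>

definition submodular_on :: "'a set \<Rightarrow> ('a set \<Rightarrow> real) \<Rightarrow> bool" where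
  "submodular_on S \<phi> \<longleftrightarrow>
     (\<forall>X Y. X \<subseteq> S \<longrightarrow> Y \<subseteq> S \<longrightarrow> \<phi> X + \<phi> Y \<ge> \<phi> (X \<inter> Y) + \<phi> (X \<union> Y))"

definition increasing_on :: "'a set \<Rightarrow> ('a set \<Rightarrow> real) \<Rightarrow> bool" where
  "increasing_on S \<phi> \<longleftrightarrow> (\<forall>X Y. X \<subseteq> Y \<longrightarrow> Y \<subseteq> S \<longrightarrow> \<phi> X \<le> \<phi> Y)"

definition polymatroid_function_on :: "'a set \<Rightarrow> ('a set \<Rightarrow> real) \<Rightarrow> bool" where
  "polymatroid_function_on S \<phi> \<longleftrightarrow>
     (\<forall>X. X \<subseteq> S \<longrightarrow> \<phi> X \<ge> 0) \<and> increasing_on S \<phi> \<and> submodular_on S \<phi> \<and> \<phi> {} = 0"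

definition tensor_product_of ::
  "'a set \<Rightarrow> 'b set \<Rightarrow> ('a set \<Rightarrow> real) \<Rightarrow> ('b set \<Rightarrow> real) \<Rightarrow> (('a \<times> 'b) set \<Rightarrow> real) \<Rightarrow> bool" where
  "tensor_product_of S\<^sub>1 S\<^sub>2 \<phi>\<^sub>1 \<phi>\<^sub>2 \<phi> \<longleftrightarrow>
     (\<forall>X\<^sub>1 X\<^sub>2. X\<^sub>1 \<subseteq> S\<^sub>1 \<longrightarrow> X\<^sub>2 \<subseteq> S\<^sub>2 \<longrightarrow> \<phi> (X\<^sub>1 \<times> X\<^sub>2) = \<phi>\<^sub>1 X\<^sub>1 * \<phi>\<^sub>2 X\<^sub>2)"

text \<open>
  The rank function of the uniform matroid \<open>U\<^bsub>r,n\<^esub>\<close>; the size \<open>n\<close> is that of the (finite) ground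
  set and does not enter the formula.
\<close>

definition uniform_rank :: "nat \<Rightarrow> 'a set \<Rightarrow> real" where
  "uniform_rank r Y = real (min (card Y) r)"

definition ingleton_inequality ::
  "('a set \<Rightarrow> real) \<Rightarrow> 'a set \<Rightarrow> 'a set \<Rightarrow> 'a set \<Rightarrow> 'a set \<Rightarrow> bool" where
  "ingleton_inequality \<phi> A B C D \<longleftrightarrow>
     \<phi> (A \<union> B) + \<phi> (A \<union> C) + \<phi> (A \<union> D) + \<phi> (B \<union> C) + \<phi> (B \<union> D)
       \<ge> \<phi> A + \<phi> B + \<phi> (A \<union> B \<union> C) + \<phi> (A \<union> B \<union> D) + \<phi> (C \<union> D)"

end

theory Submission
  imports Defs
begin

text \<open>
  Think of \<open>S\<^sub>2 = {x, y, z}\<close> as \<open>x = e\<^sub>1\<close>, \<open>y = e\<^sub>2\<close>, \<open>z = e\<^sub>1 + e\<^sub>2\<close>. For subspaces \<open>A\<close>, \<open>B\<close> the span of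
  \<open>A \<otimes> x\<close> and \<open>B \<otimes> y\<close> meets \<open>V \<otimes> z\<close> in \<open>(A \<inter> B) \<otimes> z\<close>, so the function
  \<open>g X = \<phi> (A \<times> {x} \<union> B \<times> {y} \<union> X \<times> {z})\<close> behaves like the rank after contracting the
  common information of \<open>A\<close> and \<open>B\<close>, and the usual proof of Ingleton's inequality from common
  information goes through: it is the submodular inequality
  \<open>g C + g D \<ge> g {} + g (C \<union> D)\<close>, combined with an upper bound on \<open>g C\<close>, \<open>g D\<close> and lower bounds
  on \<open>g {}\<close>, \<open>g (C \<union> D)\<close>. Wherever the intersection of two sets is larger than what
  is needed, either disjointness makes it exact or monotonicity discards the excess.
\<close>

text \<open>\<open>F X Y Z\<close> stands for \<open>\<phi> (X \<times> {x} \<union> Y \<times> {y} \<union> Z \<times> {z})\<close>, where \<open>S\<^sub>2 = {x, y, z}\<close>.\<close>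

locale u23_tensor =
  fixes S :: "'a set" and f :: "'a set \<Rightarrow> real"
    and F :: "'a set \<Rightarrow> 'a set \<Rightarrow> 'a set \<Rightarrow> real"
  assumes submodular:
      "\<lbrakk>X \<subseteq> S; Y \<subseteq> S; Z \<subseteq> S; X' \<subseteq> S; Y' \<subseteq> S; Z' \<subseteq> S\<rbrakk> \<Longrightarrow>
        F (X \<inter> X') (Y \<inter> Y') (Z \<inter> Z') + F (X \<union> X') (Y \<union> Y') (Z \<union> Z') \<le> F X Y Z + F X' Y' Z'"
    and one: "X \<subseteq> S \<Longrightarrow> F X {} {} = f X" "X \<subseteq> S \<Longrightarrow> F {} X {} = f X" "X \<subseteq> S \<Longrightarrow> F {} {} X = f X"
    and two: "X \<subseteq> S \<Longrightarrow> F X X {} = 2 * f X" "X \<subseteq> S \<Longrightarrow> F X {} X = 2 * f X"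
      "X \<subseteq> S \<Longrightarrow> F {} X X = 2 * f X"
    and three: "X \<subseteq> S \<Longrightarrow> F X X X = 2 * f X"
begin

text \<open>\<open>upper_common\<close> is not symmetric in the x and y slots; this supplies its
  mirror image.\<close>

lemma swap: "u23_tensor S f (\<lambda>X Y Z. F Y X Z)"
  by unfold_locales (use submodular one two three in auto)

text \<open>With the meets and joins as equations, \<open>rule\<close> matches any target and
  \<open>auto\<close> checks the set identities.\<close>

lemma submodular_eq:
  assumes "X \<subseteq> S" "Y \<subseteq> S" "Z \<subseteq> S" "X' \<subseteq> S" "Y' \<subseteq> S" "Z' \<subseteq> S"
    and "I = X \<inter> X'" "J = Y \<inter> Y'" "K = Z \<inter> Z'"
    and "L = X \<union> X'" "M = Y \<union> Y'" "N = Z \<union> Z'"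
  shows "F I J K + F L M N \<le> F X Y Z + F X' Y' Z'"
  using submodular assms by simp

text \<open>y lies in the span of x and z: since \<open>F T {} T\<close> and \<open>F T T T\<close>
  agree, adding T in the y slot cannot raise the value.\<close>

lemma add_third_upper:
  assumes "T \<subseteq> U" "U \<subseteq> S"
  shows "F U T U \<le> 2 * f U"
proof -
  have "F T {} T + F U T U \<le> F U {} U + F T T T"
    by (rule submodular_eq) (use assms in auto)
  then show ?thesis
    using two(2)[of T] two(2)[of U] three[of T] assms by auto
qed

text \<open>A substitute for monotonicity: the values with T and with \<open>U - T\<close> in the y
  slot sum to at least \<open>4 * f U\<close>, and the latter is at most
  \<open>2 * f U\<close>.\<close>

lemma add_third_lower:
  assumes "T \<subseteq> U" "U \<subseteq> S"
  shows "2 * f U \<le> F U T U"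
proof -
  have "F U {} U + F U U U \<le> F U T U + F U (U - T) U"
    by (rule submodular_eq) (use assms in auto)
  then show ?thesis
    using add_third_upper[of "U - T" U] two(2)[of U] three[of U] assms by auto
qed

text \<open>Enlarging the x slot to U costs at most \<open>f U - f T\<close> and reaches a value of
  at least \<open>2 * f U\<close>.\<close>

lemma lower_nested:
  assumes "T \<subseteq> U" "U \<subseteq> S"
  shows "f T + f U \<le> F T T U"
proof -
  have "F T {} {} + F U T U \<le> F T T U + F U {} {}"
    by (rule submodular_eq) (use assms in auto)
  then show ?thesis
    using add_third_lower[OF assms] one(1)[of T] one(1)[of U] assms by auto
qed

text \<open>Enlarge one slot after the other until the set is a product over
  \<open>A \<union> B\<close>, whose value is known.\<close>

lemma lower_two:
  assumes "A \<subseteq> S" "B \<subseteq> S"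
  shows "f A + f B \<le> F A B {}"
proof -
  have "F A {} {} + F (A \<union> B) B {} \<le> F A B {} + F (A \<union> B) {} {}"
    by (rule submodular_eq) (use assms in auto)
  moreover have "F {} B {} + F (A \<union> B) (A \<union> B) {} \<le> F (A \<union> B) B {} + F {} (A \<union> B) {}"
    by (rule submodular_eq) (use assms in auto)
  ultimately show ?thesis
    using assms one(1)[of A] one(1)[of "A \<union> B"] one(2)[of B] one(2)[of "A \<union> B"]
      two(1)[of "A \<union> B"] by auto
qed

text \<open>Start from the product \<open>F B B B\<close>, of value only \<open>2 * f B\<close>, and
  enlarge the x and z slots by diminishing returns.\<close>

lemma upper_common:
  assumes "A \<subseteq> S" "B \<subseteq> S" "C \<subseteq> S"
  shows "F (A \<union> B) B (B \<union> C) \<le> f (A \<union> B) + f (B \<union> C)"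
proof -
  have "F B {} {} + F (A \<union> B) B B \<le> F B B B + F (A \<union> B) {} {}"
    by (rule submodular_eq) (use assms in auto)
  moreover have "F {} {} B + F (A \<union> B) B (B \<union> C) \<le> F (A \<union> B) B B + F {} {} (B \<union> C)"
    by (rule submodular_eq) (use assms in auto)
  ultimately show ?thesis
    using assms one(1)[of B] one(3)[of B] one(1)[of "A \<union> B"] one(3)[of "B \<union> C"] three[of B]
    by auto
qed

lemma ingleton:
  assumes S: "A \<subseteq> S" "B \<subseteq> S" "C \<subseteq> S" "D \<subseteq> S"
    and mono_or_disjoint:
      "(\<forall>X Y Z X' Y' Z'. X \<subseteq> X' \<longrightarrow> Y \<subseteq> Y' \<longrightarrow> Z \<subseteq> Z' \<longrightarrow> X' \<subseteq> S \<longrightarrow> Y' \<subseteq> S \<longrightarrow> Z' \<subseteq> S \<longrightarrow>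
          F X Y Z \<le> F X' Y' Z')
       \<or> A \<inter> B = {} \<and> C \<inter> D = {}"
  shows "ingleton_inequality f A B C D"
proof -
  \<comment> \<open>Both parts of the theorem at once: I, J, K may lie below the true meet if F is
    monotone, and must equal it in the disjoint case.\<close>
  have submodular_le: "F I J K + F L M N \<le> F X Y Z + F X' Y' Z'"
    if "X \<subseteq> S" "Y \<subseteq> S" "Z \<subseteq> S" "X' \<subseteq> S" "Y' \<subseteq> S" "Z' \<subseteq> S"
      and "L = X \<union> X'" "M = Y \<union> Y'" "N = Z \<union> Z'"
      and "I \<subseteq> X \<inter> X'" "J \<subseteq> Y \<inter> Y'" "K \<subseteq> Z \<inter> Z'"
      and "A \<inter> B = {} \<and> C \<inter> D = {} \<Longrightarrow> X \<inter> X' \<subseteq> I \<and> Y \<inter> Y' \<subseteq> J \<and> Z \<inter> Z' \<subseteq> K"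
    for X Y Z X' Y' Z' I J K L M N
  proof -
    have "F I J K \<le> F (X \<inter> X') (Y \<inter> Y') (Z \<inter> Z')"
      using mono_or_disjoint
    proof
      assume "A \<inter> B = {} \<and> C \<inter> D = {}"
      with that(10-13) have "I = X \<inter> X'" "J = Y \<inter> Y'" "K = Z \<inter> Z'"
        by blast+
      then show ?thesis by simp
    qed (use that(1-6,10-12) in \<open>simp add: le_infI1\<close>)
    then show ?thesis
      using submodular[OF that(1-6)] that(7-9) by simp
  qed
  have upper: "F A B E \<le> f (A \<union> B) + f (A \<union> E) + f (B \<union> E) - f (A \<union> B \<union> E)" if E: "E \<subseteq> S" for E
  proof -
    \<comment> \<open>The z slots meet in \<open>(A \<inter> B) \<union> E\<close>, which is E in
      the disjoint case.\<close>
    have "F A B E + F (A \<union> B) (A \<union> B) (A \<union> B \<union> E)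
        \<le> F (A \<union> B) B (B \<union> E) + F A (A \<union> B) (A \<union> E)"
      by (rule submodular_le) (use S E in auto)
    moreover have "F (A \<union> B) B (B \<union> E) \<le> f (A \<union> B) + f (B \<union> E)"
      by (rule upper_common[OF S(1,2) E])
    moreover have "F A (A \<union> B) (A \<union> E) \<le> f (A \<union> B) + f (A \<union> E)"
      using u23_tensor.upper_common[OF swap S(2,1) E] by (simp add: Un_commute)
    moreover have "f (A \<union> B) + f (A \<union> B \<union> E) \<le> F (A \<union> B) (A \<union> B) (A \<union> B \<union> E)"
      by (rule lower_nested) (use S E in auto)
    ultimately show ?thesis by linarith
  qed
  define U where "U = A \<union> B \<union> C \<union> D"
  have U: "U \<subseteq> S" "A \<union> B \<subseteq> U" "C \<union> D \<subseteq> U"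
    using S by (auto simp: U_def)
  have lower: "f (A \<union> B) + f (C \<union> D) \<le> F A B (C \<union> D)"
  proof -
    have "F {} {} (C \<union> D) + F A B U \<le> F A B (C \<union> D) + F {} {} U"
      by (rule submodular_eq) (use S U in auto)
    \<comment> \<open>A in slots x and z already spans A in slot y, so this enlargement is free; the
      next step does the same with B in slots y and z.\<close>
    moreover have "F A {} A + F A (A \<union> B) U \<le> F A B U + F A A A"
      by (rule submodular_le) (use S U in auto)
    moreover have "F {} B B + F (A \<union> B) (A \<union> B) U \<le> F A (A \<union> B) U + F B B B"
      by (rule submodular_le) (use S U in auto)
    moreover have "f (A \<union> B) + f U \<le> F (A \<union> B) (A \<union> B) U"
      using U by (intro lower_nested)
    ultimately show ?thesis
      using S U one(3)[of "C \<union> D"] one(3)[of U] two(2)[of A] two(3)[of B] three[of A] three[of B]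
      by auto
  qed
  have "F A B {} + F A B (C \<union> D) \<le> F A B C + F A B D"
    by (rule submodular_le) (use S in auto)
  then show ?thesis
    using upper[OF S(3)] upper[OF S(4)] lower lower_two[OF S(1,2)]
    unfolding ingleton_inequality_def by linarith
qed

end

text \<open>Meets and joins act slicewise, and \<open>min (card Y) 2\<close> gives the factors 1, 2,
  2 for one, two or three equal slices.\<close>

lemma u23_tensor_slices:
  assumes xyz: "x \<noteq> y" "x \<noteq> z" "y \<noteq> z" and S2: "S\<^sub>2 = {x, y, z}"
    and rank: "\<forall>Y. Y \<subseteq> S\<^sub>2 \<longrightarrow> \<phi>\<^sub>2 Y = uniform_rank 2 Y"
    and tensor: "tensor_product_of S\<^sub>1 S\<^sub>2 \<phi>\<^sub>1 \<phi>\<^sub>2 \<phi>"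
    and sub: "submodular_on (S\<^sub>1 \<times> S\<^sub>2) \<phi>"
  shows "u23_tensor S\<^sub>1 \<phi>\<^sub>1 (\<lambda>X Y Z. \<phi> (X \<times> {x} \<union> Y \<times> {y} \<union> Z \<times> {z}))"
proof -
  let ?t = "\<lambda>X Y Z. X \<times> {x} \<union> Y \<times> {y} \<union> Z \<times> {z}"
  have prod: "\<phi> R = \<phi>\<^sub>1 X * real (min (card Y) 2)" if "X \<subseteq> S\<^sub>1" "Y \<subseteq> S\<^sub>2" "R = X \<times> Y" for R X Y
    using tensor rank that unfolding tensor_product_of_def uniform_rank_def by simp
  show ?thesis
  proof
    fix X Y Z X' Y' Z' assume *: "X \<subseteq> S\<^sub>1" "Y \<subseteq> S\<^sub>1" "Z \<subseteq> S\<^sub>1" "X' \<subseteq> S\<^sub>1" "Y' \<subseteq> S\<^sub>1" "Z' \<subseteq> S\<^sub>1"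
    have "?t (X \<inter> X') (Y \<inter> Y') (Z \<inter> Z') = ?t X Y Z \<inter> ?t X' Y' Z'"
      "?t (X \<union> X') (Y \<union> Y') (Z \<union> Z') = ?t X Y Z \<union> ?t X' Y' Z'"
      using xyz by auto
    moreover have "?t X Y Z \<subseteq> S\<^sub>1 \<times> S\<^sub>2" "?t X' Y' Z' \<subseteq> S\<^sub>1 \<times> S\<^sub>2"
      using * S2 by auto
    ultimately show "\<phi> (?t (X \<inter> X') (Y \<inter> Y') (Z \<inter> Z')) + \<phi> (?t (X \<union> X') (Y \<union> Y') (Z \<union> Z'))
        \<le> \<phi> (?t X Y Z) + \<phi> (?t X' Y' Z')"
      using sub unfolding submodular_on_def by simp
  next
    fix X assume X: "X \<subseteq> S\<^sub>1"
    show "\<phi> (?t X {} {}) = \<phi>\<^sub>1 X" using prod[OF X, of "{x}"] S2 by simp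
    show "\<phi> (?t {} X {}) = \<phi>\<^sub>1 X" using prod[OF X, of "{y}"] S2 by simp
    show "\<phi> (?t {} {} X) = \<phi>\<^sub>1 X" using prod[OF X, of "{z}"] S2 by simp
    show "\<phi> (?t X X {}) = 2 * \<phi>\<^sub>1 X" by (subst prod[OF X, of "{x, y}"]) (use S2 xyz in auto)
    show "\<phi> (?t X {} X) = 2 * \<phi>\<^sub>1 X" by (subst prod[OF X, of "{x, z}"]) (use S2 xyz in auto)
    show "\<phi> (?t {} X X) = 2 * \<phi>\<^sub>1 X" by (subst prod[OF X, of "{y, z}"]) (use S2 xyz in auto)
    show "\<phi> (?t X X X) = 2 * \<phi>\<^sub>1 X" by (subst prod[OF X, of "{x, y, z}"]) (use S2 xyz in auto)
  qed
qed

theorem theorem3p10: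
  fixes S\<^sub>1 :: "'a set" and S\<^sub>2 :: "'b set"
    and \<phi>\<^sub>1 :: "'a set \<Rightarrow> real" and \<phi>\<^sub>2 :: "'b set \<Rightarrow> real"
  assumes "finite S\<^sub>1"
    and "submodular_on S\<^sub>1 \<phi>\<^sub>1"
    and "card S\<^sub>2 = 3"
    and "\<forall>Y. Y \<subseteq> S\<^sub>2 \<longrightarrow> \<phi>\<^sub>2 Y = uniform_rank 2 Y"
  shows "((\<exists>\<phi>. tensor_product_of S\<^sub>1 S\<^sub>2 \<phi>\<^sub>1 \<phi>\<^sub>2 \<phi> \<and> submodular_on (S\<^sub>1 \<times> S\<^sub>2) \<phi>) \<longrightarrow>
           (\<forall>A B C D. A \<subseteq> S\<^sub>1 \<longrightarrow> B \<subseteq> S\<^sub>1 \<longrightarrow> C \<subseteq> S\<^sub>1 \<longrightarrow> D \<subseteq> S\<^sub>1 \<longrightarrow>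
              A \<inter> B = {} \<longrightarrow> A \<inter> C = {} \<longrightarrow> A \<inter> D = {} \<longrightarrow>
              B \<inter> C = {} \<longrightarrow> B \<inter> D = {} \<longrightarrow> C \<inter> D = {} \<longrightarrow>
              ingleton_inequality \<phi>\<^sub>1 A B C D))
       \<and> ((\<exists>\<phi>. tensor_product_of S\<^sub>1 S\<^sub>2 \<phi>\<^sub>1 \<phi>\<^sub>2 \<phi> \<and> polymatroid_function_on (S\<^sub>1 \<times> S\<^sub>2) \<phi>) \<longrightarrow>
           (\<forall>A B C D. A \<subseteq> S\<^sub>1 \<longrightarrow> B \<subseteq> S\<^sub>1 \<longrightarrow> C \<subseteq> S\<^sub>1 \<longrightarrow> D \<subseteq> S\<^sub>1 \<longrightarrow>
              ingleton_inequality \<phi>\<^sub>1 A B C D))"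
proof -
  obtain x y z where xyz: "x \<noteq> y" "x \<noteq> z" "y \<noteq> z" and S2: "S\<^sub>2 = {x, y, z}"
    using assms(3) by (auto simp: card_3_iff)
  note slices = u23_tensor_slices[OF xyz S2 assms(4)]
  show ?thesis
  proof (intro conjI impI allI; elim exE conjE)
    fix A B C D \<phi>
    assume ABCD: "A \<subseteq> S\<^sub>1" "B \<subseteq> S\<^sub>1" "C \<subseteq> S\<^sub>1" "D \<subseteq> S\<^sub>1"
      and disjoint: "A \<inter> B = {}" "C \<inter> D = {}"
      and hyps: "tensor_product_of S\<^sub>1 S\<^sub>2 \<phi>\<^sub>1 \<phi>\<^sub>2 \<phi>" "submodular_on (S\<^sub>1 \<times> S\<^sub>2) \<phi>"
    show "ingleton_inequality \<phi>\<^sub>1 A B C D"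
      by (rule u23_tensor.ingleton[OF slices[OF hyps] ABCD disjI2[OF conjI[OF disjoint]]])
  next
    fix A B C D \<phi>
    assume ABCD: "A \<subseteq> S\<^sub>1" "B \<subseteq> S\<^sub>1" "C \<subseteq> S\<^sub>1" "D \<subseteq> S\<^sub>1"
      and tensor: "tensor_product_of S\<^sub>1 S\<^sub>2 \<phi>\<^sub>1 \<phi>\<^sub>2 \<phi>"
      and "polymatroid_function_on (S\<^sub>1 \<times> S\<^sub>2) \<phi>"
    then have sub: "submodular_on (S\<^sub>1 \<times> S\<^sub>2) \<phi>" and incr: "increasing_on (S\<^sub>1 \<times> S\<^sub>2) \<phi>"
      unfolding polymatroid_function_on_def by auto
    have mono: "\<phi> (X \<times> {x} \<union> Y \<times> {y} \<union> Z \<times> {z}) \<le> \<phi> (X' \<times> {x} \<union> Y' \<times> {y} \<union> Z' \<times> {z})"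
      if "X \<subseteq> X'" "Y \<subseteq> Y'" "Z \<subseteq> Z'" "X' \<subseteq> S\<^sub>1" "Y' \<subseteq> S\<^sub>1" "Z' \<subseteq> S\<^sub>1" for X Y Z X' Y' Z'
      by (rule incr[unfolded increasing_on_def, rule_format]) (use that S2 in auto)
    show "ingleton_inequality \<phi>\<^sub>1 A B C D"
      by (rule u23_tensor.ingleton[OF slices[OF tensor sub] ABCD])
        (intro disjI1 allI impI mono)
  qed
qed

end
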